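(* Let $\alpha,\beta\in(0,1]$. (1) The Green's function corresponding to the homogeneous problem $-D^{\beta}D^{\alpha}x(t)=0$ with the conjugate boundary conditions $x(0)=x(1)=0$ is $$G(t,s)=\begin{cases}\frac1\alpha t^{\alpha}(1-s^{\alpha}) & : t\le s,\\ \frac1\alpha s^{\alpha}(1-t^{\alpha}) & : s\le t,\end{cases}\qquad t,s\in[0,1].$$ (2) The Green's function corresponding to the homogeneous problem $-D^{\beta}D^{\alpha}x(t)=0$ with the right-focal-type boundary conditions $x(0)=D^{\alpha}x(1)=0$ is $$G(t,s)=\begin{cases}\frac1\alpha t^{\alpha} & : t\le s,\\ \frac1\alpha s^{\alpha} & : s\le t,\end{cases}\qquad t,s\in[0,1].$$ In each case this means that for every continuous function $h$ on $[0,1]$, the function $x(t)=\int_0^1G(t,s)h(s)s^{\beta-1}\,ds$ is a solution of $-D^{\beta}D^{\alpha}x(t)=h(t)$ on $[0,1]$ satisfying the respective boundary conditions.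
   Context: For $\alpha\in(0,1]$ the conformable fractional derivative of order $\alpha$ of a function $f$ is $D^{\alpha}f(t):=\lim_{\varepsilon\to0}\frac{f(te^{\varepsilon t^{-\alpha}})-f(t)}{\varepsilon}$ for $t>0$, and $D^{\alpha}f(0):=\lim_{t\to0^+}D^{\alpha}f(t)$; if $f$ is differentiable at $t>0$ then $D^{\alpha}f(t)=t^{1-\alpha}f'(t)$. For functions on $[0,1]$ the derivative at $t=1$ is one-sided. $D^{\beta}D^{\alpha}x$ means $D^{\beta}(D^{\alpha}x)$. The term "Green's function" is meant in the sense spelled out in the claim (kernel of the solution operator with respect to the weight $s^{\beta-1}\,ds$). *)

theory Defs
  imports "HOL-Analysis.Analysis"
begin

text \<open>
  Conformable derivatives of functions on \<open>[0,1]\<close>; HOL functions are total, so the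
  increments are restricted to those that stay in \<open>[0,1]\<close>. The restriction is void in the limit
  for \<open>0 < t < 1\<close> and makes the derivative one-sided at \<open>t = 1\<close>.
\<close>

definition has_conf_deriv_pos :: "real \<Rightarrow> (real \<Rightarrow> real) \<Rightarrow> real \<Rightarrow> real \<Rightarrow> bool" where
  "has_conf_deriv_pos \<alpha> f D t \<longleftrightarrow>
     ((\<lambda>\<epsilon>. (f (t * exp (\<epsilon> * t powr (-\<alpha>))) - f t) / \<epsilon>) \<longlongrightarrow> D)
       (at 0 within {\<epsilon>. t * exp (\<epsilon> * t powr (-\<alpha>)) \<in> {0..1}})"

definition has_conf_deriv :: "real \<Rightarrow> (real \<Rightarrow> real) \<Rightarrow> real \<Rightarrow> real \<Rightarrow> bool" where
  "has_conf_deriv \<alpha> f D t \<longleftrightarrow>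
     (if t = 0
      then \<exists>g. (\<forall>\<^sub>F s in at_right 0. has_conf_deriv_pos \<alpha> f (g s) s) \<and> (g \<longlongrightarrow> D) (at_right 0)
      else has_conf_deriv_pos \<alpha> f D t)"

definition conf_differentiable :: "real \<Rightarrow> (real \<Rightarrow> real) \<Rightarrow> real \<Rightarrow> bool" where
  "conf_differentiable \<alpha> f t \<longleftrightarrow> (\<exists>D. has_conf_deriv \<alpha> f D t)"

text \<open>Meaningful only where the function is conformable differentiable.\<close>

definition conf_deriv :: "real \<Rightarrow> (real \<Rightarrow> real) \<Rightarrow> real \<Rightarrow> real" where
  "conf_deriv \<alpha> f t = (THE D. has_conf_deriv \<alpha> f D t)"

definition conf_solution :: "real \<Rightarrow> real \<Rightarrow> (real \<Rightarrow> real) \<Rightarrow> (real \<Rightarrow> real) \<Rightarrow> bool" where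
  "conf_solution \<alpha> \<beta> h x \<longleftrightarrow>
     (\<forall>t\<in>{0..1}. conf_differentiable \<alpha> x t) \<and>
     (\<forall>t\<in>{0..1}. conf_differentiable \<beta> (conf_deriv \<alpha> x) t \<and>
                 - conf_deriv \<beta> (conf_deriv \<alpha> x) t = h t)"

text \<open>
  The predicate \<open>bc\<close> expresses the boundary conditions. Integrability is demanded explicitly since
  \<open>integral\<close> is \<open>0\<close> on non-integrable functions; the value of \<open>s powr (\<beta> - 1)\<close> at \<open>s = 0\<close>, which is
  \<open>0\<close> by convention, does not affect the integral.
\<close>

definition conf_green_function ::
  "real \<Rightarrow> real \<Rightarrow> ((real \<Rightarrow> real) \<Rightarrow> bool) \<Rightarrow> (real \<Rightarrow> real \<Rightarrow> real) \<Rightarrow> bool" where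
  "conf_green_function \<alpha> \<beta> bc G \<longleftrightarrow>
     (\<forall>h. continuous_on {0..1} h \<longrightarrow>
        (\<forall>t\<in>{0..1}. (\<lambda>s. G t s * h s * s powr (\<beta> - 1)) absolutely_integrable_on {0..1}) \<and>
        (let x = (\<lambda>t. integral {0..1} (\<lambda>s. G t s * h s * s powr (\<beta> - 1)))
         in conf_solution \<alpha> \<beta> h x \<and> bc x))"

end

theory Submission
  imports Defs
begin

text \<open>
  Write \<open>k s = h s * s powr (\<beta> - 1)\<close>, which is integrable because \<open>\<beta> > 0\<close>. The right-focal kernel is
  \<open>min t s powr \<alpha> / \<alpha>\<close>, and subtracting the product \<open>t powr \<alpha> * s powr \<alpha> / \<alpha>\<close> from it gives the
  conjugate kernel. Splitting the integral at \<open>t\<close>, both candidate solutions therefore have the form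
  \<open>x t = (\<integral> s in 0..t. s powr \<alpha> / \<alpha> * k s) + t powr \<alpha> / \<alpha> * (\<integral> s in t..1. k s) - c * t powr \<alpha>\<close>
  with a constant \<open>c\<close>, which is \<open>0\<close> for the right-focal conditions and is determined by \<open>x 1 = 0\<close>
  for the conjugate ones.

  As \<open>k\<close> is continuous on \<open>(0,1]\<close>, the fundamental theorem of calculus gives
  \<open>x' t = t powr (\<alpha> - 1) * ((\<integral> s in t..1. k s) - c * \<alpha>)\<close> there: the two terms \<open>t powr \<alpha> / \<alpha> * k t\<close>
  cancel. Since \<open>D\<^sup>\<alpha> f t = t powr (1 - \<alpha>) * f' t\<close>, the singular factor disappears and
  \<open>D\<^sup>\<alpha> x t = (\<integral> s in t..1. k s) - c * \<alpha>\<close>. This function is continuous on all of \<open>[0,1]\<close>, so the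
  formula persists at \<open>t = 0\<close>. The same rule, applied to it, yields \<open>D\<^sup>\<beta> D\<^sup>\<alpha> x = - h\<close>, and there
  the case \<open>t = 0\<close> is the continuity of \<open>h\<close>.

  The rule with its extension to \<open>0\<close> is \<open>has_conf_deriv_unit_interval\<close>, the computation of the
  two derivatives is \<open>conf_solution_variation_of_parameters\<close>, and the passage from the kernels to
  the formula for \<open>x\<close> is \<open>conf_green_function_min_minus_product\<close>.
\<close>

section \<open>Conformable derivatives of differentiable functions\<close>

text \<open>
  The conformable difference quotient is the ordinary difference quotient of
  \<open>\<epsilon> \<mapsto> f (t * exp (\<epsilon> * t powr (- \<alpha>)))\<close> at \<open>0\<close>, so this is the chain rule.
\<close>

lemma has_conf_deriv_pos_if_has_real_derivative:
  assumes "0 < t" and f: "(f has_real_derivative D) (at t within {0..1})"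
  shows "has_conf_deriv_pos \<alpha> f (t powr (1 - \<alpha>) * D) t"
proof -
  define \<phi> where "\<phi> = (\<lambda>\<epsilon>. t * exp (\<epsilon> * t powr (-\<alpha>)))"
  define E where "E = {\<epsilon>. \<phi> \<epsilon> \<in> {0..1}}"
  have "(\<phi> has_real_derivative t * t powr (-\<alpha>)) (at 0 within E)"
    unfolding \<phi>_def by (auto intro!: derivative_eq_intros)
  moreover have "t * t powr (-\<alpha>) = t powr (1 - \<alpha>)"
    using \<open>0 < t\<close> powr_add[of t 1 "-\<alpha>"] by simp
  ultimately have \<phi>: "(\<phi> has_real_derivative t powr (1 - \<alpha>)) (at 0 within E)"
    by simp
  have \<phi>0: "\<phi> 0 = t"
    by (simp add: \<phi>_def)
  have "(f has_real_derivative D) (at (\<phi> 0) within \<phi> ` E)"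
    unfolding \<phi>0 by (rule DERIV_subset[OF f]) (auto simp: E_def)
  from DERIV_image_chain[OF this \<phi>]
  have "((\<lambda>\<epsilon>. (f (\<phi> \<epsilon>) - f t) / \<epsilon>) \<longlongrightarrow> D * t powr (1 - \<alpha>)) (at 0 within E)"
    by (simp add: has_field_derivative_iff \<phi>0)
  then show ?thesis
    by (simp add: has_conf_deriv_pos_def \<phi>_def E_def mult.commute)
qed

text \<open>
  The increments \<open>\<epsilon> < 0\<close> keep the argument inside \<open>[0,1]\<close>, so \<open>0\<close> is a limit point of the
  admissible increments and limits along them are unique.
\<close>

lemma has_conf_deriv_pos_unique:
  assumes "0 < t" "t \<le> 1"
    and "has_conf_deriv_pos \<alpha> f D t" "has_conf_deriv_pos \<alpha> f D' t"
  shows "D = D'"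
proof -
  define E where "E = {\<epsilon>. t * exp (\<epsilon> * t powr (-\<alpha>)) \<in> {0..1}}"
  have "t * exp (\<epsilon> * t powr (-\<alpha>)) \<le> 1 * 1" if "\<epsilon> < 0" for \<epsilon>
    using assms(1,2) that by (intro mult_mono) (auto simp: mult_nonpos_nonneg)
  then have "{..<0} \<subseteq> E"
    using assms(1) by (auto simp: E_def)
  then have "at_left 0 \<le> at 0 within E"
    by (rule at_le)
  then have "at 0 within E \<noteq> bot"
    using trivial_limit_at_left_real[of 0] by (auto simp: bot_unique)
  then show ?thesis
    using assms(3,4) unfolding has_conf_deriv_pos_def E_def[symmetric] by (rule tendsto_unique)
qed

lemma has_conf_deriv_unique:
  assumes t: "t \<in> {0..1}" and D: "has_conf_deriv \<alpha> f D t" and D': "has_conf_deriv \<alpha> f D' t"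
  shows "D = D'"
proof (cases "t = 0")
  case False
  with t D D' show ?thesis
    by (intro has_conf_deriv_pos_unique[of t \<alpha> f]) (auto simp: has_conf_deriv_def)
next
  case True
  then obtain g g' where g: "\<forall>\<^sub>F s in at_right 0. has_conf_deriv_pos \<alpha> f (g s) s" "(g \<longlongrightarrow> D) (at_right 0)"
    and g': "\<forall>\<^sub>F s in at_right 0. has_conf_deriv_pos \<alpha> f (g' s) s" "(g' \<longlongrightarrow> D') (at_right 0)"
    using D D' by (auto simp: has_conf_deriv_def)
  have "\<forall>\<^sub>F s in at_right (0::real). s \<in> {0<..<1}"
    by (rule eventually_at_rightI) auto
  with g(1) g'(1) have "\<forall>\<^sub>F s in at_right 0. g s = g' s"
    by eventually_elim (auto intro: has_conf_deriv_pos_unique)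
  with g(2) have "(g' \<longlongrightarrow> D) (at_right 0)"
    using tendsto_cong by fast
  with g'(2) show ?thesis
    using tendsto_unique trivial_limit_at_right_real by blast
qed

text \<open>
  On \<open>(0,1]\<close> the conformable derivative is \<open>t powr (1 - \<alpha>) * f' t\<close>; a continuous extension \<open>u\<close> of
  this expression to \<open>[0,1]\<close> has the right value at \<open>0\<close>, where the derivative is defined as a limit.
\<close>

lemma has_conf_deriv_unit_interval:
  assumes f: "\<And>t. 0 < t \<Longrightarrow> t \<le> 1 \<Longrightarrow> (f has_real_derivative f' t) (at t within {0..1})"
    and u: "\<And>t. 0 < t \<Longrightarrow> t \<le> 1 \<Longrightarrow> u t = t powr (1 - \<alpha>) * f' t"
    and cont: "continuous_on {0..1} u"
    and t: "t \<in> {0..1}"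
  shows "has_conf_deriv \<alpha> f (u t) t"
proof -
  have pos: "has_conf_deriv_pos \<alpha> f (u s) s" if "0 < s" "s \<le> 1" for s
    using has_conf_deriv_pos_if_has_real_derivative[OF that(1) f[OF that]] u[OF that] by simp
  show ?thesis
  proof (cases "t = 0")
    case True
    have "\<forall>\<^sub>F s in at_right 0. has_conf_deriv_pos \<alpha> f (u s) s"
      by (rule eventually_at_rightI[of 0 1]) (auto intro: pos)
    moreover have "(u \<longlongrightarrow> u 0) (at 0 within {0..1})"
      using cont by (auto simp: continuous_on_def)
    then have "(u \<longlongrightarrow> u 0) (at_right 0)"
      by (simp add: at_within_Icc_at_right)
    ultimately show ?thesis
      using True by (auto simp: has_conf_deriv_def)
  next
    case False
    then show ?thesis
      using pos t by (auto simp: has_conf_deriv_def)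
  qed
qed

lemma conf_deriv_eqI:
  assumes "t \<in> {0..1}" "has_conf_deriv \<alpha> f D t"
  shows "conf_deriv \<alpha> f t = D"
  unfolding conf_deriv_def using assms by (blast intro: has_conf_deriv_unique)

section \<open>Integrals with the weight \<open>s powr (\<beta> - 1)\<close>\<close>

lemma absolutely_integrable_continuous_times_powr:
  fixes h :: "real \<Rightarrow> real"
  assumes "0 < \<beta>" and h: "continuous_on {0..1} h"
  shows "(\<lambda>s. h s * s powr (\<beta> - 1)) absolutely_integrable_on {0..1}"
proof (rule absolutely_integrable_bounded_measurable_product_real)
  show "h \<in> borel_measurable (lebesgue_on {0..1})"
    using h by (simp add: continuous_imp_measurable_on_sets_lebesgue)
  show "bounded (h ` {0..1})"
    using h by (intro compact_imp_bounded compact_continuous_image) auto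
  have "(\<lambda>s. s powr (\<beta> - 1)) integrable_on {0..1}"
    using \<open>0 < \<beta>\<close> by (intro integrable_on_powr_from_0) auto
  then show "(\<lambda>s. s powr (\<beta> - 1)) absolutely_integrable_on {0..1}"
    by (intro nonnegative_absolutely_integrable_1) auto
qed auto

lemma integral_upper_has_real_derivative:
  fixes k :: "real \<Rightarrow> real"
  assumes k: "k integrable_on {a..b}" and t: "t \<in> {a..b}" and "continuous (at t within {a..b}) k"
  shows "((\<lambda>t. integral {a..t} k) has_real_derivative k t) (at t within {a..b})"
  using integral_has_vector_derivative_continuous_at[OF k, of t "{}"] assms
  by (simp add: has_real_derivative_iff_has_vector_derivative)

lemma has_field_derivative_transform:
  assumes "t \<in> S" "\<And>s. s \<in> S \<Longrightarrow> g s = f s" "(f has_field_derivative D) (at t within S)"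
  shows "(g has_field_derivative D) (at t within S)"
  using assms unfolding has_field_derivative_def by (rule has_derivative_transform)

lemma integral_lower_has_real_derivative:
  fixes k :: "real \<Rightarrow> real"
  assumes k: "k integrable_on {a..b}" and t: "t \<in> {a..b}" and "continuous (at t within {a..b}) k"
  shows "((\<lambda>t. integral {t..b} k) has_real_derivative - k t) (at t within {a..b})"
proof (rule has_field_derivative_transform[OF t])
  show "integral {s..b} k = integral {a..b} k - integral {a..s} k" if "s \<in> {a..b}" for s
    using Henstock_Kurzweil_Integration.integral_combine[of a s b k] that k by auto
  show "((\<lambda>s. integral {a..b} k - integral {a..s} k) has_real_derivative - k t) (at t within {a..b})"
    using integral_upper_has_real_derivative[OF assms] by (auto intro!: derivative_eq_intros)
qed

section \<open>The solution operator\<close>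

text \<open>
  The common form of both candidate solutions: variation of parameters with the fundamental system
  \<open>1, t powr \<alpha>\<close>, where \<open>c\<close> is the parameter left free by the condition \<open>x 0 = 0\<close>.
\<close>

lemma conf_solution_variation_of_parameters:
  fixes \<alpha> \<beta> c :: real and h x :: "real \<Rightarrow> real"
  defines "k \<equiv> \<lambda>s. h s * s powr (\<beta> - 1)"
  assumes "0 < \<alpha>" "0 < \<beta>" and h: "continuous_on {0..1} h"
    and x: "\<And>t. t \<in> {0..1} \<Longrightarrow> x t = integral {0..t} (\<lambda>s. s powr \<alpha> / \<alpha> * k s)
                                     + t powr \<alpha> / \<alpha> * integral {t..1} k - c * t powr \<alpha>"
  shows "conf_solution \<alpha> \<beta> h x"
    and "\<And>t. t \<in> {0..1} \<Longrightarrow> conf_deriv \<alpha> x t = integral {t..1} k - c * \<alpha>"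
proof -
  define u where "u = (\<lambda>t. integral {t..1} k - c * \<alpha>)"
  have k_int: "k integrable_on {0..1}"
    unfolding k_def using absolutely_integrable_continuous_times_powr[OF \<open>0 < \<beta>\<close> h]
    by (rule set_lebesgue_integral_eq_integral)
  have "continuous_on {0..1} (\<lambda>s. s powr \<alpha> / \<alpha> * h s)"
    using h \<open>0 < \<alpha>\<close> by (auto intro!: continuous_intros continuous_on_powr')
  from absolutely_integrable_continuous_times_powr[OF \<open>0 < \<beta>\<close> this]
  have pk_int: "(\<lambda>s. s powr \<alpha> / \<alpha> * k s) integrable_on {0..1}"
    unfolding k_def mult.assoc by (rule set_lebesgue_integral_eq_integral)
  have k_cont: "continuous (at t within {0..1}) k" if "0 < t" "t \<le> 1" for t
    unfolding k_def using h that
    by (intro continuous_mult continuous_at_within_powr continuous_const continuous_ident)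
      (auto simp: continuous_on_eq_continuous_within)
  have u': "(u has_real_derivative - k t) (at t within {0..1})" if "0 < t" "t \<le> 1" for t
    unfolding u_def using that
    by (auto intro!: derivative_eq_intros integral_lower_has_real_derivative k_int k_cont)
  have x': "(x has_real_derivative t powr (\<alpha> - 1) * u t) (at t within {0..1})"
    if "0 < t" "t \<le> 1" for t
  proof (rule has_field_derivative_transform[OF _ x])
    have "continuous (at t within {0..1}) (\<lambda>s. s powr \<alpha> / \<alpha> * k s)"
      using that \<open>0 < \<alpha>\<close>
      by (intro continuous_mult continuous_divide continuous_at_within_powr continuous_const
            continuous_ident k_cont) auto
    then have P: "((\<lambda>t. integral {0..t} (\<lambda>s. s powr \<alpha> / \<alpha> * k s)) has_real_derivative
                t powr \<alpha> / \<alpha> * k t) (at t within {0..1})"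
      using that pk_int by (intro integral_upper_has_real_derivative) auto
    have Q: "((\<lambda>t. integral {t..1} k) has_real_derivative - k t) (at t within {0..1})"
      using that by (auto intro!: integral_lower_has_real_derivative k_int k_cont)
    have R: "((\<lambda>t. t powr \<alpha>) has_real_derivative \<alpha> * t powr (\<alpha> - 1)) (at t within {0..1})"
      using that has_real_derivative_powr has_field_derivative_at_within by blast
    show "((\<lambda>t. integral {0..t} (\<lambda>s. s powr \<alpha> / \<alpha> * k s) + t powr \<alpha> / \<alpha> * integral {t..1} k
             - c * t powr \<alpha>) has_real_derivative t powr (\<alpha> - 1) * u t) (at t within {0..1})"
      by (rule DERIV_cong[OF DERIV_diff[OF DERIV_add[OF P DERIV_mult[OF DERIV_cdivide[OF R] Q]]
              DERIV_cmult[OF R]]])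
        (use \<open>0 < \<alpha>\<close> in \<open>simp add: u_def field_simps\<close>)
  qed (use that in auto)
  have powr_cancel: "t powr (1 - r) * t powr (r - 1) = 1" if "0 < t" for t r :: real
    using that powr_add[of t "1 - r" "r - 1"] by simp
  have u_cont: "continuous_on {0..1} u"
    unfolding u_def by (intro continuous_intros indefinite_integral_continuous_1' k_int)
  have x_deriv: "has_conf_deriv \<alpha> x (u t) t" if "t \<in> {0..1}" for t
    using x' _ u_cont that
    by (rule has_conf_deriv_unit_interval) (simp_all add: powr_cancel mult.assoc[symmetric])
  then have x_eq: "conf_deriv \<alpha> x t = u t" if "t \<in> {0..1}" for t
    using that by (blast intro: conf_deriv_eqI)
  then show "\<And>t. t \<in> {0..1} \<Longrightarrow> conf_deriv \<alpha> x t = integral {t..1} k - c * \<alpha>"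
    by (simp add: u_def)
  have Dx': "(conf_deriv \<alpha> x has_real_derivative - k t) (at t within {0..1})"
    if "0 < t" "t \<le> 1" for t
    using that by (intro has_field_derivative_transform[OF _ x_eq u']) auto
  have "has_conf_deriv \<beta> (conf_deriv \<alpha> x) (- h t) t" if "t \<in> {0..1}" for t
  proof (rule has_conf_deriv_unit_interval[OF Dx' _ _ that])
    show "- h t = t powr (1 - \<beta>) * - k t" if "0 < t" for t
      using powr_cancel[OF that, of \<beta>] by (simp add: k_def algebra_simps)
  qed (use h in \<open>auto intro: continuous_intros\<close>)
  with x_deriv show "conf_solution \<alpha> \<beta> h x"
    unfolding conf_solution_def conf_differentiable_def
    by (metis conf_deriv_eqI minus_minus)
qed

section \<open>The two Green's functions\<close>

lemma focal_green_function_eq_min: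
  fixes t s \<alpha> :: real
  shows "(if t \<le> s then 1 / \<alpha> * t powr \<alpha> else 1 / \<alpha> * s powr \<alpha>) = min t s powr \<alpha> / \<alpha>"
  by (simp add: min_def)

lemma conjugate_green_function_eq_min:
  fixes t s \<alpha> :: real
  shows "(if t \<le> s then 1 / \<alpha> * t powr \<alpha> * (1 - s powr \<alpha>) else 1 / \<alpha> * s powr \<alpha> * (1 - t powr \<alpha>))
       = min t s powr \<alpha> / \<alpha> - t powr \<alpha> * (s powr \<alpha> / \<alpha>)"
  by (simp add: min_def algebra_simps diff_divide_distrib)

text \<open>
  Conjugate and right-focal conditions are treated at once: their kernels are the instances
  \<open>d = 1\<close> and \<open>d = 0\<close>. In the assumption on the boundary conditions, \<open>I\<close> is the integral of
  \<open>s powr \<alpha> / \<alpha> * h s * s powr (\<beta> - 1)\<close> over \<open>[0,1]\<close>; the subtracted product kernel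
  contributes \<open>d * I * t powr \<alpha>\<close> to the solution, which therefore is the one with
  \<open>c = d * I\<close> in \<open>conf_solution_variation_of_parameters\<close>.
\<close>

lemma conf_green_function_min_minus_product:
  fixes \<alpha> \<beta> d :: real
  assumes "0 < \<alpha>" "0 < \<beta>"
    and bc: "\<And>x I. \<lbrakk>x 0 = 0; x 1 = (1 - d) * I; conf_deriv \<alpha> x 1 = - d * \<alpha> * I\<rbrakk> \<Longrightarrow> bc x"
  shows "conf_green_function \<alpha> \<beta> bc (\<lambda>t s. min t s powr \<alpha> / \<alpha> - d * (t powr \<alpha> * (s powr \<alpha> / \<alpha>)))"
  unfolding conf_green_function_def Let_def
proof (intro allI impI conjI ballI)
  fix h :: "real \<Rightarrow> real"
  assume h: "continuous_on {0..1} h"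
  define k where "k = (\<lambda>s. h s * s powr (\<beta> - 1))"
  define G where "G = (\<lambda>t s. min t s powr \<alpha> / \<alpha> - d * (t powr \<alpha> * (s powr \<alpha> / \<alpha>)))"
  define x where "x = (\<lambda>t. integral {0..1} (\<lambda>s. G t s * h s * s powr (\<beta> - 1)))"
  define I where "I = integral {0..1} (\<lambda>s. s powr \<alpha> / \<alpha> * k s)"
  have abs_int: "(\<lambda>s. g s * h s * s powr (\<beta> - 1)) absolutely_integrable_on {0..1}"
    if "continuous_on {0..1} g" for g :: "real \<Rightarrow> real"
    using that h by (intro absolutely_integrable_continuous_times_powr \<open>0 < \<beta>\<close> continuous_on_mult)
  have int: "(\<lambda>s. g s * k s) integrable_on {0..1}" if "continuous_on {0..1} g" for g :: "real \<Rightarrow> real"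
    using abs_int[OF that] unfolding k_def mult.assoc by (rule set_lebesgue_integral_eq_integral)
  have min_cont: "continuous_on {0..1} (\<lambda>s. min t s powr \<alpha> / \<alpha>)" if "t \<in> {0..1}" for t
    using that \<open>0 < \<alpha>\<close> by (auto intro!: continuous_intros continuous_on_powr')
  have powr_cont: "continuous_on {0..1} (\<lambda>s. s powr \<alpha> / \<alpha>)"
    using \<open>0 < \<alpha>\<close> by (auto intro!: continuous_intros continuous_on_powr')
  show "(\<lambda>s. (min t s powr \<alpha> / \<alpha> - d * (t powr \<alpha> * (s powr \<alpha> / \<alpha>))) * h s * s powr (\<beta> - 1))
          absolutely_integrable_on {0..1}" if "t \<in> {0..1}" for t
    by (intro abs_int continuous_on_diff continuous_on_mult continuous_on_const
          min_cont[OF that] powr_cont)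
  have x_eq: "x t = integral {0..t} (\<lambda>s. s powr \<alpha> / \<alpha> * k s)
                  + t powr \<alpha> / \<alpha> * integral {t..1} k - (d * I) * t powr \<alpha>"
    if t: "t \<in> {0..1}" for t
  proof -
    have "x t = integral {0..1} (\<lambda>s. min t s powr \<alpha> / \<alpha> * k s
                                 - d * t powr \<alpha> * (s powr \<alpha> / \<alpha> * k s))"
      unfolding x_def G_def k_def by (simp add: algebra_simps)
    also have "\<dots> = integral {0..1} (\<lambda>s. min t s powr \<alpha> / \<alpha> * k s)
                 - integral {0..1} (\<lambda>s. d * t powr \<alpha> * (s powr \<alpha> / \<alpha> * k s))"
      using int[OF min_cont[OF t]] integrable_on_mult_right[OF int[OF powr_cont]]
      by (rule Henstock_Kurzweil_Integration.integral_diff)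
    also have "integral {0..1} (\<lambda>s. d * t powr \<alpha> * (s powr \<alpha> / \<alpha> * k s)) = (d * I) * t powr \<alpha>"
      unfolding integral_mult_right I_def by simp
    also have "integral {0..1} (\<lambda>s. min t s powr \<alpha> / \<alpha> * k s)
             = integral {0..t} (\<lambda>s. min t s powr \<alpha> / \<alpha> * k s)
             + integral {t..1} (\<lambda>s. min t s powr \<alpha> / \<alpha> * k s)"
      using Henstock_Kurzweil_Integration.integral_combine[OF _ _ int[OF min_cont[OF t]]] t by simp
    also have "integral {0..t} (\<lambda>s. min t s powr \<alpha> / \<alpha> * k s) = integral {0..t} (\<lambda>s. s powr \<alpha> / \<alpha> * k s)"
      by (intro integral_cong) (auto simp: min_absorb2)
    also have "integral {t..1} (\<lambda>s. min t s powr \<alpha> / \<alpha> * k s)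
             = integral {t..1} (\<lambda>s. t powr \<alpha> / \<alpha> * k s)"
      by (intro integral_cong) (auto simp: min_absorb1)
    also have "\<dots> = t powr \<alpha> / \<alpha> * integral {t..1} k"
      by (rule integral_mult_right)
    finally show ?thesis .
  qed
  note solution = conf_solution_variation_of_parameters[OF \<open>0 < \<alpha>\<close> \<open>0 < \<beta>\<close> h x_eq[unfolded k_def]]
  show "conf_solution \<alpha> \<beta> h (\<lambda>t. integral {0..1} (\<lambda>s.
          (min t s powr \<alpha> / \<alpha> - d * (t powr \<alpha> * (s powr \<alpha> / \<alpha>))) * h s * s powr (\<beta> - 1)))"
    using solution(1) by (simp add: x_def G_def)
  have "bc x"
  proof (rule bc)
    show "x 0 = 0" using x_eq[of 0] by simp
    show "x 1 = (1 - d) * I" using x_eq[of 1, folded I_def] by (simp add: algebra_simps)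
    show "conf_deriv \<alpha> x 1 = - d * \<alpha> * I" using solution(2)[of 1] by simp
  qed
  then show "bc (\<lambda>t. integral {0..1} (\<lambda>s.
          (min t s powr \<alpha> / \<alpha> - d * (t powr \<alpha> * (s powr \<alpha> / \<alpha>))) * h s * s powr (\<beta> - 1)))"
    by (simp add: x_def G_def)
qed

theorem corollary2p1:
  fixes \<alpha> \<beta> :: real
  assumes "0 < \<alpha>" "\<alpha> \<le> 1" "0 < \<beta>" "\<beta> \<le> 1"
  shows "conf_green_function \<alpha> \<beta> (\<lambda>x. x 0 = 0 \<and> x 1 = 0)
           (\<lambda>t s. if t \<le> s then 1 / \<alpha> * t powr \<alpha> * (1 - s powr \<alpha>)
                  else 1 / \<alpha> * s powr \<alpha> * (1 - t powr \<alpha>))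
       \<and> conf_green_function \<alpha> \<beta> (\<lambda>x. x 0 = 0 \<and> conf_deriv \<alpha> x 1 = 0)
           (\<lambda>t s. if t \<le> s then 1 / \<alpha> * t powr \<alpha> else 1 / \<alpha> * s powr \<alpha>)"
  unfolding focal_green_function_eq_min conjugate_green_function_eq_min
  using conf_green_function_min_minus_product[OF assms(1,3), of 1 "\<lambda>x. x 0 = 0 \<and> x 1 = 0"]
    conf_green_function_min_minus_product[OF assms(1,3), of 0 "\<lambda>x. x 0 = 0 \<and> conf_deriv \<alpha> x 1 = 0"]
  by simp

end
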